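(* (i) The Banach density of $N_1$ is zero, i.e. $d^{\ast}(N_1)=0$. (ii) If $f\colon V\rightarrow \mathbb{N}$ is any function such that $f(m)\in \phi^{-1}(m)$ for every $m\in V$, then the asymptotic density of $f(V)$ is $0$. In particular, the asymptotic densities of $N_2$ and $N_3$ are zero.
   Context: $\phi$ denotes Euler's totient function, $V=\{\phi(n)\colon n\in\mathbb{N}\}$, and $\phi^{-1}(m)=\{x\in\mathbb{N}\colon \phi(x)=m\}$. For $m\in V$ let $N_1(m)=\max\{x\in\mathbb{N}\colon \phi(x)\le m\}$, $N_2(m)=\max\phi^{-1}(m)$, $N_3(m)=\min\phi^{-1}(m)$, and $N_i=\{N_i(m)\colon m\in V\}$ for $i=1,2,3$. A Følner sequence in $(\mathbb{N},+)$ is a sequence $(F_n)$ of finite subsets of $\mathbb{N}$ with $\lim_{n\to\infty}|(g+F_n)\cap F_n|/|F_n|=1$ for all $g\in\mathbb{N}$. The upper density of $A\subset\mathbb{N}$ with respect to $(F_n)$ is $\overline d_{F_n}(A)=\limsup_{n\to\infty}|F_n\cap A|/|F_n|$. The asymptotic density is the density (limit of $|F_n\cap A|/|F_n|$, when it exists) with respect to $F_n=\{1,\dots,n\}$. The Banach density is $d^{\ast}(A)=\sup\{\overline d_{F_n}(A)\colon (F_n) \text{ a Følner sequence in }\mathbb{N}\}$. *)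

theory Defs
  imports "HOL-Analysis.Analysis" "HOL-Number_Theory.Number_Theory"
begin

text \<open>
  Here \<open>\<nat>\<close> means the positive integers, \<^term>\<open>{1::nat..}\<close>.
\<close>

definition totient_values :: "nat set" where
  "totient_values = totient ` {1..}"

definition totient_preimage :: "nat \<Rightarrow> nat set" where
  "totient_preimage m = {x \<in> {1..}. totient x = m}"

definition N\<^sub>1 :: "nat \<Rightarrow> nat" where
  "N\<^sub>1 m = Max {x \<in> {1..}. totient x \<le> m}"

definition N\<^sub>2 :: "nat \<Rightarrow> nat" where
  "N\<^sub>2 m = Max (totient_preimage m)"

definition N\<^sub>3 :: "nat \<Rightarrow> nat" where
  "N\<^sub>3 m = Min (totient_preimage m)"

text \<open>\<^const>\<open>Max\<close> and \<^const>\<open>Min\<close> are meaningful above because the sets involved are finite.\<close>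

lemma totient_le_imp_dvd_fact:
  assumes "x > 0" "totient x \<le> m"
  shows "x dvd fact (2 * m)"
proof (rule multiplicity_le_imp_dvd)
  show "x \<noteq> 0" using assms by simp
next
  fix p :: nat assume p: "prime p"
  define k where "k = multiplicity p x"
  have "p ^ k dvd fact (2 * m)"
  proof (cases "k = 0")
    case False
    have "p ^ k dvd x" by (simp add: k_def multiplicity_dvd)
    hence "totient (p ^ k) dvd totient x" by (rule totient_dvd)
    hence le: "totient (p ^ k) \<le> m"
      using assms dvd_imp_le[of _ "totient x"] by fastforce
    have "p \<le> 2 * (p - 1)" using prime_ge_2_nat[OF p] by simp
    hence "p ^ (k - 1) * p \<le> p ^ (k - 1) * (2 * (p - 1))" by (rule mult_le_mono2)
    also have "\<dots> = 2 * totient (p ^ k)"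
      using False p by (simp add: totient_prime_power)
    finally have "p ^ k \<le> 2 * m"
      using le False by (simp add: power_eq_if mult.commute)
    thus ?thesis using p by (intro dvd_fact) (auto simp: Suc_le_eq prime_gt_0_nat)
  qed auto
  thus "multiplicity p x \<le> multiplicity p (fact (2 * m))"
    unfolding k_def using p by (intro multiplicity_geI) auto
qed

lemma finite_totient_le: "finite {x \<in> {1..}. totient x \<le> m}"
  by (rule finite_subset[OF _ finite_divisors_nat[of "fact (2 * m)"]])
     (auto intro: totient_le_imp_dvd_fact)

lemma finite_totient_preimage: "finite (totient_preimage m)"
  unfolding totient_preimage_def by (rule finite_subset[OF _ finite_totient_le[of m]]) auto

text \<open>
  Nonemptiness of the sets need not be required separately: since \<open>0 / 0 = 0\<close>, the limit
  condition forces \<open>F n\<close> to be nonempty for all large \<open>n\<close>.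
\<close>

definition folner_sequence :: "(nat \<Rightarrow> nat set) \<Rightarrow> bool" where
  "folner_sequence F \<longleftrightarrow>
     (\<forall>n. finite (F n) \<and> F n \<subseteq> {1..}) \<and>
     (\<forall>g\<in>{1..}. (\<lambda>n. real (card ((+) g ` F n \<inter> F n)) / real (card (F n))) \<longlonglongrightarrow> 1)"

definition upper_density_wrt :: "(nat \<Rightarrow> nat set) \<Rightarrow> nat set \<Rightarrow> ereal" where
  "upper_density_wrt F A = limsup (\<lambda>n. ereal (real (card (F n \<inter> A)) / real (card (F n))))"

definition has_density_wrt :: "(nat \<Rightarrow> nat set) \<Rightarrow> nat set \<Rightarrow> real \<Rightarrow> bool" where
  "has_density_wrt F A d \<longleftrightarrow> (\<lambda>n. real (card (F n \<inter> A)) / real (card (F n))) \<longlonglongrightarrow> d"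

definition has_asymptotic_density :: "nat set \<Rightarrow> real \<Rightarrow> bool" where
  "has_asymptotic_density A d \<longleftrightarrow> has_density_wrt (\<lambda>n. {1..n}) A d"

definition banach_density :: "nat set \<Rightarrow> ereal" where
  "banach_density A = (SUP F \<in> Collect folner_sequence. upper_density_wrt F A)"

end

theory Submission
  imports Defs
begin

text \<open>
  The values of \<open>N\<^sub>1\<close> are sparsely totient: \<open>\<phi>(x) > \<phi>(n)\<close> for all \<open>x > n\<close>. Every prime \<open>p\<close> divides
  all large sparsely totient \<open>n\<close>, for otherwise exchanging a large factor of \<open>n\<close> for a slightly
  larger multiple of \<open>p\<close> would give some \<open>x > n\<close> with \<open>\<phi>(x) \<le> \<phi>(n)\<close>. So the Banach density is at
  most \<open>1/p\<close> for every \<open>p\<close>.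

  A section \<open>f\<close> of \<open>\<phi>\<close> has an image on which \<open>\<phi>\<close> is injective. As \<open>\<phi>(R)/R\<close> can be made small with
  \<open>R\<close> coprime to any given number, for each \<open>k\<close> there are \<open>k\<close> pairwise coprime odd numbers \<open>R\<close> such
  that most \<open>x\<close> share a factor with each of them; for those, \<open>2\<^sup>k\<close> divides \<open>\<phi>(x) \<le> x\<close>, so that at
  most \<open>n/2\<^sup>k\<close> of them in \<open>{1..n}\<close> belong to the image.
\<close>

section \<open>Totients and divisibility\<close>

lemma prime_factors_prod_primes:
  fixes P :: "nat set"
  assumes "finite P" "\<And>p. p \<in> P \<Longrightarrow> prime p"
  shows "prime_factors (\<Prod>P) = P"
  using assms
proof (induction P rule: finite_induct)
  case (insert p P)
  have "\<Prod>P \<noteq> 0"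
    using insert not_prime_0 by (metis insertI2 prod_zero_iff)
  thus ?case
    using insert by (simp add: prime_factors_product prime_prime_factors prime_gt_0_nat)
qed auto

text \<open>By Euler's product the ratio depends only on the set of primes, and each additional
  prime contributes a factor in [0, 1].\<close>

lemma totient_ratio_antimono:
  assumes "prime_factors a \<subseteq> prime_factors b" "a > 0" "b > 0"
  shows "real (totient b) / real b \<le> real (totient a) / real a"
proof -
  have fac: "0 \<le> 1 - 1 / real p" "1 - 1 / real p \<le> 1" if "p \<in> prime_factors b" for p
    using that prime_gt_0_nat[of p] by (auto simp: divide_simps)
  have "(\<Prod>p\<in>prime_factors b. 1 - 1 / real p) \<le> (\<Prod>p\<in>prime_factors a. 1 - 1 / real p)"
  proof -
    have "(\<Prod>p\<in>prime_factors b. 1 - 1 / real p) =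
        (\<Prod>p\<in>prime_factors b - prime_factors a. 1 - 1 / real p) *
        (\<Prod>p\<in>prime_factors a. 1 - 1 / real p)"
      by (rule prod.subset_diff[OF assms(1)]) simp
    also have "\<dots> \<le> 1 * (\<Prod>p\<in>prime_factors a. 1 - 1 / real p)"
      using fac assms(1) by (intro mult_right_mono prod_le_1 prod_nonneg) auto
    finally show ?thesis by simp
  qed
  thus ?thesis
    using assms by (simp add: totient_formula2)
qed

lemma totient_mult_le: "totient (a * b) \<le> totient a * b"
proof (cases "a = 0 \<or> b = 0")
  case False
  have "real (totient (a * b)) / real (a * b) \<le> real (totient a) / real a"
    using False by (intro totient_ratio_antimono) (auto simp: prime_factors_product)
  hence "real (totient (a * b)) \<le> real (totient a * b)"
    using False by (simp add: field_simps)
  thus ?thesis by linarith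
qed auto

section \<open>The Banach density of the values of \<open>N\<^sub>1\<close>\<close>

text \<open>
  Replacing the factor \<open>q\<close> of \<open>n = q m\<close> by the next multiple of \<open>p\<close> gains a factor of
  \<open>1 - 1/p\<close> in the totient, which outweighs the increase of at most \<open>p\<close> once \<open>q \<ge> p\<^sup>2\<close>.
\<close>

lemma ex_greater_totient_le:
  assumes p: "prime p" "\<not> p dvd m" and q: "p\<^sup>2 \<le> q" and m: "m > 0"
    and le: "totient m * (q - 1) \<le> totient (q * m)"
  shows "\<exists>x>q * m. totient x \<le> totient (q * m)"
proof -
  define j where "j = q div p + 1"
  have p0: "p > 0" using p by (simp add: prime_gt_0_nat)
  have "p \<le> q div p"
    using q p0 by (simp add: less_eq_div_iff_mult_less_eq power2_eq_square)
  hence j: "p + 1 \<le> j" by (simp add: j_def)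
  have pj: "p * j = p * (q div p) + p" by (simp add: j_def algebra_simps)
  have qd: "p * (q div p) + q mod p = q" by simp
  have "q mod p < p" using p0 by simp
  hence gt: "p * j > q" using pj qd by linarith
  \<comment> \<open>\<open>p * j\<close> is at most \<open>q + p\<close>; subtracting
    \<open>j\<close>, which is at least \<open>p + 1\<close> because
    \<open>p\<^sup>2 \<le> q\<close>, leaves at most \<open>q - 1\<close>.\<close>
  have "(p - 1) * j = p * j - j" by (simp add: diff_mult_distrib)
  also have "\<dots> \<le> q - 1" using pj qd j by linarith
  finally have pj_le: "(p - 1) * j \<le> q - 1" .
  have "totient (m * p * j) \<le> totient (m * p) * j" by (rule totient_mult_le)
  also have "totient (m * p) = totient m * (p - 1)"
    using p prime_imp_coprime[of p m] by (simp add: totient_mult_coprime totient_prime coprime_commute)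
  also have "totient m * (p - 1) * j \<le> totient m * (q - 1)"
    using pj_le by (simp add: mult.assoc)
  also note le
  finally have "totient (m * p * j) \<le> totient (q * m)" .
  moreover have "m * p * j > q * m"
    using gt m by (simp add: mult.assoc mult.commute)
  ultimately show ?thesis by blast
qed

text \<open>If \<open>p\<close> does not divide \<open>n\<close>, two choices of the factor
  \<open>q\<close> to be exchanged bound \<open>n\<close>: prime factors, which must then be below
  \<open>p\<^sup>2\<close>, and the quotient of \<open>n\<close> by its radical, which must be
  too.\<close>

lemma prime_dvd_sparsely_totient:
  assumes n: "\<And>x. x > n \<Longrightarrow> totient x > totient n"
    and p: "prime p" and large: "n \<ge> p\<^sup>2 * fact (p\<^sup>2)"
  shows "p dvd n"
proof (rule ccontr)
  assume ndvd: "\<not> p dvd n"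
  hence n0: "n > 0" by (auto intro: Nat.gr0I)
  \<comment> \<open>The bound with \<open>q - 1\<close> instead of \<open>q\<close> admits a prime
    \<open>q\<close> dividing \<open>n\<close> exactly once.\<close>
  have key: False
    if nqm: "n = q * m" and q: "p\<^sup>2 \<le> q" and le: "totient m * (q - 1) \<le> totient n" for q m
  proof -
    have "\<not> p dvd m" "m > 0" using ndvd n0 nqm by auto
    from ex_greater_totient_le[OF p this(1) q this(2)] le
    obtain x where "x > n" "totient x \<le> totient n" unfolding nqm by blast
    with n show False by (simp add: not_le[symmetric])
  qed
  have small: "r < p\<^sup>2" if r: "r \<in> prime_factors n" for r
  proof (rule ccontr)
    assume "\<not> r < p\<^sup>2"
    hence r2: "p\<^sup>2 \<le> r" by simp
    have pr: "prime r" using r by auto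
    obtain m where m: "n = r * m" using r by auto
    have "totient m * (r - 1) \<le> totient n"
    proof (cases "r dvd m")
      case False
      hence "coprime r m" using pr by (simp add: prime_imp_coprime)
      thus ?thesis using pr by (simp add: m totient_mult_coprime totient_prime)
    next
      case True
      hence "gcd r m = r" by (simp add: gcd_nat.absorb1)
      with totient_gcd[of r m] have "totient (r * m) = totient m * r"
        using pr by (simp add: prime_gt_0_nat)
      thus ?thesis by (simp add: m)
    qed
    with key[OF m r2] show False by blast
  qed
  \<comment> \<open>The radical has the same primes as \<open>n\<close>, hence the same totient
    ratio, so \<open>totient n = totient m * q\<close> for the cofactor \<open>q\<close>.\<close>
  define m where "m = \<Prod>(prime_factors n)"
  have pf: "prime_factors m = prime_factors n"
    unfolding m_def by (rule prime_factors_prod_primes) auto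
  have m0: "m > 0" unfolding m_def by (auto intro!: prod_pos intro: prime_gt_0_nat)
  have "m dvd (\<Prod>r\<in>prime_factors n. r ^ multiplicity r n)"
    unfolding m_def by (intro prod_dvd_prod dvd_power) (auto simp: prime_factors_multiplicity)
  hence "m dvd n" using prime_factorization_nat[of n] n0 by simp
  then obtain q where q: "n = q * m" by (metis dvd_def mult.commute)
  have "real (totient n) / real n = real (totient m) / real m"
    using totient_ratio_antimono[of m n] totient_ratio_antimono[of n m] pf n0 m0 by auto
  hence "real (totient n) = real (totient m * q)"
    using n0 m0 by (simp add: q field_simps)
  hence "totient n = totient m * q" by linarith
  hence "\<not> p\<^sup>2 \<le> q" using key[OF q] by auto
  have "m dvd \<Prod>{1..p\<^sup>2}"
    unfolding m_def using small
    by (intro prod_dvd_prod_subset) (auto simp: less_imp_le Suc_le_eq in_prime_factors_iff prime_gt_0_nat)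
  hence "m \<le> fact (p\<^sup>2)"
    by (intro dvd_imp_le) (auto simp: fact_prod)
  with \<open>\<not> p\<^sup>2 \<le> q\<close> have "n < p\<^sup>2 * fact (p\<^sup>2)"
    unfolding q by (intro mult_less_le_imp_less) (auto simp: m0)
  with large show False by simp
qed

text \<open>By maximality everything beyond \<open>N\<^sub>1 m\<close> has totient above
  \<open>m\<close>.\<close>

lemma N1_sparsely_totient:
  assumes m: "m \<in> totient_values" and x: "x > N\<^sub>1 m"
  shows "totient x > totient (N\<^sub>1 m)"
proof -
  let ?S = "{x \<in> {1..}. totient x \<le> m}"
  have "m \<ge> 1"
    using m by (auto simp: totient_values_def Suc_le_eq)
  hence "1 \<in> ?S" by simp
  hence "N\<^sub>1 m \<in> ?S"
    unfolding N\<^sub>1_def using finite_totient_le[of m] by (intro Max_in) auto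
  moreover have "x \<notin> ?S"
    using x Max_ge[OF finite_totient_le[of m], of x] unfolding N\<^sub>1_def by auto
  ultimately show ?thesis using x by auto
qed

section \<open>Folner sequences and disjoint translates\<close>

lemma folner_sequence_intervals: "folner_sequence (\<lambda>n. {1..n})"
  unfolding folner_sequence_def
proof (intro conjI allI ballI)
  fix g :: nat
  have "(\<lambda>n. 1 - real g / real n) \<longlonglongrightarrow> 1 - 0"
    by (intro tendsto_intros lim_const_over_n)
  moreover have "\<forall>\<^sub>F n in sequentially.
      1 - real g / real n = real (card ((+) g ` {1..n} \<inter> {1..n})) / real (card {1..n})"
    using eventually_ge_at_top[of "g + 1"]
  proof eventually_elim
    case (elim n)
    have "(+) g ` {1..n} \<inter> {1..n} = {g + 1..n}" using elim by auto
    thus ?case using elim by (simp add: of_nat_diff field_simps)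
  qed
  ultimately show "(\<lambda>n. real (card ((+) g ` {1..n} \<inter> {1..n})) / real (card {1..n})) \<longlonglongrightarrow> 1"
    by (simp add: tendsto_cong)
qed auto

text \<open>Each translate of \<open>F n \<inter> B\<close> stays in \<open>F n\<close> up to a
  proportion \<open>\<epsilon>\<close> of \<open>F n\<close>, and the \<open>k\<close> disjoint
  remainders all fit into \<open>F n\<close>.\<close>

lemma folner_disjoint_shifts:
  assumes F: "folner_sequence F" and k: "k > 0" and \<epsilon>: "\<epsilon> > 0"
    and disj: "disjoint_family_on (\<lambda>i. (+) (g i) ` B) {..<k}"
  shows "\<forall>\<^sub>F n in sequentially. real (card (F n \<inter> B)) \<le> (1 / real k + \<epsilon>) * real (card (F n))"
proof -
  have fin: "finite (F n)" for n using F by (simp add: folner_sequence_def)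
  have "\<forall>\<^sub>F n in sequentially. (1 - \<epsilon>) * real (card (F n)) \<le> real (card ((+) h ` F n \<inter> F n))" for h
  \<comment> \<open>The Folner condition speaks of positive shifts only; the zero shift is
    trivial.\<close>
  proof (cases "h = 0")
    case True
    thus ?thesis using \<epsilon> by (simp add: image_def mult_left_le_one_le algebra_simps)
  next
    case False
    hence "(\<lambda>n. real (card ((+) h ` F n \<inter> F n)) / real (card (F n))) \<longlonglongrightarrow> 1"
      using F by (simp add: folner_sequence_def)
    hence "\<forall>\<^sub>F n in sequentially. 1 - \<epsilon> < real (card ((+) h ` F n \<inter> F n)) / real (card (F n))"
      using \<epsilon> by (intro order_tendstoD) auto
    thus ?thesis
    proof eventually_elim
      case (elim n)
      show ?case
      proof (cases "card (F n) = 0")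
        case False
        thus ?thesis using elim by (simp add: field_simps)
      qed simp
    qed
  qed
  hence "\<forall>\<^sub>F n in sequentially.
      \<forall>i\<in>{..<k}. (1 - \<epsilon>) * real (card (F n)) \<le> real (card ((+) (g i) ` F n \<inter> F n))"
    by (simp add: eventually_ball_finite_distrib)
  thus ?thesis
  proof eventually_elim
    case (elim n)
    let ?c = "real (card (F n))"
    \<comment> \<open>Points lost from \<open>F n \<inter> B\<close> are among the points of the
      translated \<open>F n\<close> outside \<open>F n\<close>, at most a proportion
      \<open>\<epsilon>\<close>.\<close>
    have one: "real (card (F n \<inter> B)) - \<epsilon> * ?c \<le> real (card ((+) (g i) ` (F n \<inter> B) \<inter> F n))"
      if i: "i < k" for i
    proof -
      have c: "card ((+) (g i) ` F n) = card (F n)" "card ((+) (g i) ` (F n \<inter> B)) = card (F n \<inter> B)"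
        by (auto intro!: card_image)
      have "card ((+) (g i) ` F n) = card ((+) (g i) ` F n \<inter> F n) + card ((+) (g i) ` F n - F n)"
        by (subst card_Un_disjoint[symmetric]) (auto simp: fin intro!: arg_cong[where f = card])
      moreover have "?c - \<epsilon> * ?c \<le> real (card ((+) (g i) ` F n \<inter> F n))"
        using elim i by (simp add: left_diff_distrib)
      ultimately have d: "real (card ((+) (g i) ` F n - F n)) \<le> \<epsilon> * ?c"
        using c by linarith
      have "card (F n \<inter> B) = card ((+) (g i) ` (F n \<inter> B))" using c by simp
      also have "\<dots> \<le> card (((+) (g i) ` (F n \<inter> B) \<inter> F n) \<union> ((+) (g i) ` F n - F n))"
        by (intro card_mono) (auto simp: fin)
      also have "\<dots> \<le> card ((+) (g i) ` (F n \<inter> B) \<inter> F n) + card ((+) (g i) ` F n - F n)"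
        by (rule card_Un_le)
      finally show ?thesis using d by linarith
    qed
    have "real k * (real (card (F n \<inter> B)) - \<epsilon> * ?c)
        = (\<Sum>i<k. real (card (F n \<inter> B)) - \<epsilon> * ?c)" by simp
    also have "\<dots> \<le> (\<Sum>i<k. real (card ((+) (g i) ` (F n \<inter> B) \<inter> F n)))"
      by (intro sum_mono one) auto
    also have "\<dots> = real (card (\<Union>i\<in>{..<k}. (+) (g i) ` (F n \<inter> B) \<inter> F n))"
      using disj unfolding disjoint_family_on_def
      by (subst card_UN_disjoint) (simp_all add: fin, blast)
    also have "\<dots> \<le> ?c"
      by (intro of_nat_mono card_mono) (auto simp: fin)
    finally show ?case using k by (simp add: field_simps)
  qed
qed

lemma upper_density_wrt_eq_0:
  assumes "\<And>e. e > 0 \<Longrightarrow> \<forall>\<^sub>F n in sequentially. real (card (F n \<inter> A)) \<le> e * real (card (F n))"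
  shows "upper_density_wrt F A = 0"
proof -
  have "(\<lambda>n. real (card (F n \<inter> A)) / real (card (F n))) \<longlonglongrightarrow> 0"
  proof (rule tendstoI)
    fix e :: real assume "e > 0"
    hence "\<forall>\<^sub>F n in sequentially. real (card (F n \<inter> A)) \<le> e / 2 * real (card (F n))"
      by (intro assms) simp
    thus "\<forall>\<^sub>F n in sequentially. dist (real (card (F n \<inter> A)) / real (card (F n))) 0 < e"
    proof eventually_elim
      case (elim n)
      have "real (card (F n \<inter> A)) / real (card (F n)) \<le> e / 2"
        using elim \<open>e > 0\<close> by (cases "card (F n) = 0") (auto simp: divide_le_eq)
      also have "\<dots> < e" using \<open>e > 0\<close> by simp
      finally show ?case by simp
    qed
  qed
  hence "(\<lambda>n. ereal (real (card (F n \<inter> A)) / real (card (F n)))) \<longlonglongrightarrow> ereal 0"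
    by (rule tendsto_ereal)
  thus ?thesis
    unfolding upper_density_wrt_def by (simp add: lim_imp_Limsup zero_ereal_def)
qed

text \<open>\<open>A\<close> is covered by the numbers below \<open>K\<close> and the multiples of
  \<open>p\<close>. Both sets have \<open>p\<close> disjoint translates, so each fills
  asymptotically at most 1/p of a Folner set, and \<open>p\<close> is arbitrary.\<close>

lemma banach_density_eventually_divisible:
  assumes A: "\<And>p. prime p \<Longrightarrow> \<exists>K. \<forall>n\<in>A. n \<ge> K \<longrightarrow> p dvd n"
  shows "banach_density A = 0"
proof -
  have "upper_density_wrt F A = 0" if F: "folner_sequence F" for F
  proof (rule upper_density_wrt_eq_0)
    fix e :: real assume e: "e > 0"
    \<comment> \<open>Each of the two pieces will contribute \<open>1 / p + e / 4\<close>, which is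
      then at most \<open>e / 2\<close>.\<close>
    obtain p where p: "prime p" "p > nat \<lceil>4 / e\<rceil>" using bigger_prime by blast
    have p0: "p > 0" using p by (simp add: prime_gt_0_nat)
    have "4 / e < real p" using p by linarith
    hence pe: "1 / real p \<le> e / 4" using e p0 by (simp add: field_simps)
    from A[OF p(1)] obtain K where K: "\<And>n. n \<in> A \<Longrightarrow> n \<ge> K \<Longrightarrow> p dvd n" by blast
    have fin: "finite (F n)" for n using F by (simp add: folner_sequence_def)
    \<comment> \<open>The translates are consecutive blocks of length \<open>K\<close>, told apart
      by division by \<open>K\<close>; those of the multiples of \<open>p\<close> below are told
      apart by residues.\<close>
    have "disjoint_family_on (\<lambda>i. (+) (i * K) ` {..<K}) {..<p}"
    proof -
      have "i = (i * K + x) div K" if "x < K" for i x using that by simp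
      thus ?thesis unfolding disjoint_family_on_def by (auto, metis)
    qed
    from folner_disjoint_shifts[OF F p0 _ this, of "e / 4"] e
    have 1: "\<forall>\<^sub>F n in sequentially.
        real (card (F n \<inter> {..<K})) \<le> (1 / real p + e / 4) * real (card (F n))" by simp
    have "disjoint_family_on (\<lambda>i. (+) i ` {x. p dvd x}) {..<p}"
    proof -
      have "i = (i + x) mod p" if "i < p" "p dvd x" for i x
        using that by (auto elim!: dvdE)
      thus ?thesis unfolding disjoint_family_on_def by (auto, metis)
    qed
    from folner_disjoint_shifts[OF F p0 _ this, of "e / 4"] e
    have 2: "\<forall>\<^sub>F n in sequentially.
        real (card (F n \<inter> {x. p dvd x})) \<le> (1 / real p + e / 4) * real (card (F n))" by simp
    from 1 2 show "\<forall>\<^sub>F n in sequentially. real (card (F n \<inter> A)) \<le> e * real (card (F n))"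
    proof eventually_elim
      case (elim n)
      have "card (F n \<inter> A) \<le> card ((F n \<inter> {..<K}) \<union> (F n \<inter> {x. p dvd x}))"
        using K by (intro card_mono) (auto simp: fin not_less[symmetric])
      also have "\<dots> \<le> card (F n \<inter> {..<K}) + card (F n \<inter> {x. p dvd x})"
        by (rule card_Un_le)
      finally have "real (card (F n \<inter> A)) \<le> (2 * (1 / real p + e / 4)) * real (card (F n))"
        using elim by (simp add: algebra_simps)
      also have "\<dots> \<le> e * real (card (F n))"
        using pe by (intro mult_right_mono) auto
      finally show ?case .
    qed
  qed
  hence "upper_density_wrt F A = 0" if "F \<in> Collect folner_sequence" for F
    using that by simp
  \<comment> \<open>The supremum of the constant 0 is 0 only over a nonempty family.\<close>
  moreover have "Collect folner_sequence \<noteq> {}"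
    using folner_sequence_intervals by blast
  ultimately show ?thesis
    unfolding banach_density_def by (simp add: SUP_eq_const)
qed

section \<open>Sets on which the totient function is injective\<close>

text \<open>Sum \<open>\<phi>(n) / n \<le> \<phi>(d) / d\<close> over the divisors \<open>d\<close> of \<open>n\<close>.\<close>

lemma totient_mult_divisor_sum_le: "totient n * (\<Sum>d | d dvd n. d) \<le> n\<^sup>2"
proof (cases "n = 0")
  case False
  have "totient n * d \<le> n * totient d" if "d dvd n" for d
  proof -
    from that obtain c where c: "n = d * c" by auto
    have "totient n * d \<le> (totient d * c) * d"
      unfolding c by (intro mult_right_mono totient_mult_le) auto
    thus ?thesis by (simp add: c mult_ac)
  qed
  hence "(\<Sum>d | d dvd n. totient n * d) \<le> (\<Sum>d | d dvd n. n * totient d)"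
    by (intro sum_mono) auto
  thus ?thesis
    by (simp add: sum_distrib_left[symmetric] totient_divisor_sum power2_eq_square)
qed auto

text \<open>For \<open>n = fact N\<close> the numbers \<open>n div k\<close> with
  \<open>k \<le> N\<close> are distinct divisors, so the divisor sum is at least
  \<open>n * harm N\<close> and the ratio at most \<open>1 / harm N\<close>. The harmonic series
  diverges.\<close>

lemma ex_totient_ratio_less:
  assumes "\<epsilon> > 0"
  shows "\<exists>n>0. real (totient n) / real n < \<epsilon>"
proof -
  have "\<forall>\<^sub>F N in sequentially. harm N > 1 / \<epsilon>"
    using harm_at_top unfolding filterlim_at_top_dense by blast
  then obtain N where N: "harm N > 1 / \<epsilon>"
    using eventually_happens' sequentially_bot by blast
  define n :: nat where "n = fact N"
  have n0: "n > 0" by (simp add: n_def)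
  have "real n * harm N = (\<Sum>k\<in>{1..N}. real (n div k))"
    unfolding harm_def sum_distrib_left
    by (intro sum.cong) (auto simp: n_def real_of_nat_div dvd_fact field_simps)
  also have "\<dots> = real (\<Sum>((div) n ` {1..N}))"
  proof -
    have "inj_on ((div) n) {1..N}"
    proof (rule inj_onI)
      fix a b assume ab: "a \<in> {1..N}" "b \<in> {1..N}" "n div a = n div b"
      hence "a dvd n" "b dvd n" by (auto simp: n_def dvd_fact)
      hence "a * (n div a) = n" "b * (n div b) = n" by simp_all
      hence "a * (n div a) = b * (n div a)" using ab by simp
      moreover have "n div a \<noteq> 0" using \<open>a * (n div a) = n\<close> n0 by (metis mult_0_right not_less0)
      ultimately show "a = b" by simp
    qed
    thus ?thesis by (simp add: sum.reindex)
  qed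
  also have "\<dots> \<le> real (\<Sum>d | d dvd n. d)"
  proof (intro of_nat_mono sum_mono2)
    have "n div k dvd n" if "k \<in> {1..N}" for k
      using that by (intro dvdI[of _ _ k]) (simp add: n_def dvd_fact)
    thus "(div) n ` {1..N} \<subseteq> {d. d dvd n}" by blast
  qed (use n0 in auto)
  finally have "real (totient n) * (real n * harm N) \<le> real (totient n) * real (\<Sum>d | d dvd n. d)"
    by (intro mult_left_mono) auto
  also have "\<dots> = real (totient n * (\<Sum>d | d dvd n. d))" by simp
  also have "\<dots> \<le> real (n\<^sup>2)"
    by (intro of_nat_mono totient_mult_divisor_sum_le)
  finally have le: "real (totient n) * harm N \<le> real n"
    using n0 by (simp add: power2_eq_square mult_ac)
  have "real (totient n) * (1 / \<epsilon>) < real (totient n) * harm N"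
    using N n0 by (intro mult_strict_left_mono) auto
  also note le
  finally have "real (totient n) / real n < \<epsilon>"
    using n0 assms by (simp add: field_simps)
  with n0 show ?thesis by blast
qed

text \<open>Deleting the primes of \<open>M\<close> from \<open>Q\<close> raises the ratio by at
  most the factor \<open>M / totient M\<close>, so \<open>Q\<close> is chosen with a ratio smaller
  by that factor.\<close>

lemma ex_coprime_totient_ratio_less:
  assumes "\<epsilon> > 0" "M > 0"
  shows "\<exists>n>0. coprime n M \<and> real (totient n) / real n < \<epsilon>"
proof -
  have "\<epsilon> * (real (totient M) / real M) > 0" using assms by simp
  from ex_totient_ratio_less[OF this] obtain Q where Q: "Q > 0"
    "real (totient Q) / real Q < \<epsilon> * (real (totient M) / real M)" by blast
  define R where "R = \<Prod>(prime_factors Q - prime_factors M)"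
  have R0: "R > 0" unfolding R_def by (auto intro!: prod_pos intro: prime_gt_0_nat)
  have pf: "prime_factors R = prime_factors Q - prime_factors M"
    unfolding R_def by (rule prime_factors_prod_primes) auto
  have cop: "coprime R M"
  proof (rule ccontr)
    assume "\<not> coprime R M"
    hence "gcd R M \<noteq> 1" by (simp only: coprime_iff_gcd_eq_1 not_False_eq_True)
    then obtain p where p: "prime p" "p dvd gcd R M"
      using prime_factor_nat by blast
    hence "p \<in> prime_factors R" "p \<in> prime_factors M"
      using R0 assms by (auto simp: in_prime_factors_iff)
    thus False using pf by blast
  qed
  have "real (totient R) / real R * (real (totient M) / real M)
      = real (totient (R * M)) / real (R * M)"
    using cop by (simp add: totient_mult_coprime)
  also have "\<dots> \<le> real (totient Q) / real Q"
    using Q R0 assms pf by (intro totient_ratio_antimono) (auto simp: prime_factors_product)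
  also note Q(2)
  finally have "real (totient R) / real R < \<epsilon>"
    using assms by (simp only: mult_less_cancel_right_pos of_nat_0_less_iff totient_gt_0_iff
        divide_pos_pos)
  with R0 cop show ?thesis by blast
qed

text \<open>Each new member is taken coprime to twice the product of the earlier ones; the factor 2
  makes it odd.\<close>

lemma ex_pairwise_coprime_totient_ratio_less:
  assumes "0 < \<epsilon>" "\<epsilon> \<le> 1"
  shows "\<exists>S. finite S \<and> card S = k \<and> pairwise coprime S \<and>
           (\<forall>n\<in>S. odd n \<and> real (totient n) / real n < \<epsilon>)"
proof (induction k)
  case 0
  show ?case by (rule exI[of _ "{}"]) auto
next
  case (Suc k)
  then obtain S where S: "finite S" "card S = k" "pairwise coprime S"
    "\<And>n. n \<in> S \<Longrightarrow> odd n \<and> real (totient n) / real n < \<epsilon>" by blast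
  have "2 * \<Prod>S > 0" using S(4) by (auto intro!: prod_pos intro: odd_pos)
  from ex_coprime_totient_ratio_less[OF assms(1) this] obtain n where n:
    "coprime n (2 * \<Prod>S)" "real (totient n) / real n < \<epsilon>" by blast
  have cop: "coprime n s" if "s \<in> S" for s
    using n(1) that S(1) by (meson coprime_divisors dvd_mult dvd_prodI dvd_refl)
  \<comment> \<open>Otherwise \<open>n\<close> is coprime to itself, so \<open>n = 1\<close>, whose
    ratio 1 is not below \<open>\<epsilon> \<le> 1\<close>.\<close>
  have "n \<notin> S"
  proof
    assume "n \<in> S"
    from cop[OF this] have "n = 1" by simp
    thus False using n assms by simp
  qed
  moreover have "odd n" using n(1) by auto
  ultimately show ?case using S n cop
    by (intro exI[of _ "insert n S"]) (auto simp: pairwise_insert coprime_commute)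
qed

text \<open>The gcds of \<open>x\<close> with the members of \<open>S\<close> are pairwise coprime
  odd divisors of \<open>x\<close>. None is 1, so all exceed 2 and have even totient.\<close>

lemma power_two_dvd_totient:
  assumes "finite S" "pairwise coprime S" "\<And>n. n \<in> S \<Longrightarrow> odd n \<and> \<not> coprime x n"
  shows "2 ^ card S dvd totient x"
proof -
  have "(\<Prod>n\<in>S. gcd x n) dvd x \<and> 2 ^ card S dvd totient (\<Prod>n\<in>S. gcd x n)"
    using assms
  proof (induction S rule: finite_induct)
    case (insert n S)
    have IH: "(\<Prod>n\<in>S. gcd x n) dvd x" "2 ^ card S dvd totient (\<Prod>n\<in>S. gcd x n)"
      using insert by (auto simp: pairwise_insert)
    have "coprime n s" if "s \<in> S" for s
      using insert that by (auto simp: pairwise_insert)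
    hence cop: "coprime (gcd x n) (\<Prod>n\<in>S. gcd x n)"
      by (intro prod_coprime_right) (meson coprime_divisors gcd_dvd2)
    have "gcd x n \<noteq> 1" "odd n" using insert.prems(2)[of n] by (simp_all only: coprime_iff_gcd_eq_1 insertI1 simp_thms)
    hence "odd (gcd x n)" by (meson dvd_trans gcd_dvd2)
    with \<open>gcd x n \<noteq> 1\<close> have "gcd x n > 2" 
      by (metis One_nat_def dvd_0_right dvd_refl less_2_cases linorder_neqE_nat)
    hence "even (totient (gcd x n))" by (rule totient_even)
    hence "2 * 2 ^ card S dvd totient (gcd x n) * totient (\<Prod>n\<in>S. gcd x n)"
      using IH by (intro mult_dvd_mono)
    moreover have "gcd x n * (\<Prod>n\<in>S. gcd x n) dvd x"
      using cop IH by (intro divides_mult) auto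
    ultimately show ?case using insert cop by (simp add: totient_mult_coprime)
  qed auto
  thus ?thesis by (meson dvd_trans totient_dvd)
qed

section \<open>Counting in the intervals \<open>{1..n}\<close>\<close>

lemma card_coprime_le:
  assumes "R > 0"
  shows "card {x \<in> {1..n}. coprime x R} \<le> (n div R + 1) * totient R"
proof -
  have "{x \<in> {1..n}. coprime x R} \<subseteq> (\<lambda>(i, t). i * R + t) ` ({..n div R} \<times> totatives R)"
  proof
    fix x assume "x \<in> {x \<in> {1..n}. coprime x R}"
    hence x: "1 \<le> x" "x \<le> n" "coprime x R" by auto
    \<comment> \<open>Shifting by one makes \<open>t\<close> range over \<open>{1..R}\<close>, as
      totatives do.\<close>
    define i t where "i = (x - 1) div R" and "t = (x - 1) mod R + 1"
    have eq: "x = i * R + t" using x by (simp add: i_def t_def)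
    have "i \<le> n div R" unfolding i_def using x by (intro div_le_mono) auto
    moreover have "t > 0" "t \<le> R" using assms by (auto simp: t_def Suc_le_eq)
    moreover have "coprime t R"
      using x(3) unfolding eq by (metis add.commute coprime_iff_gcd_eq_1 gcd.commute gcd_add_mult)
    ultimately show "x \<in> (\<lambda>(i, t). i * R + t) ` ({..n div R} \<times> totatives R)"
      using eq by (force simp: in_totatives_iff)
  qed
  hence "card {x \<in> {1..n}. coprime x R} \<le> card ({..n div R} \<times> totatives R)"
    by (intro surj_card_le) auto
  thus ?thesis by (simp add: card_cartesian_product totient_def)
qed

text \<open>The sum counts the numbers coprime to some \<open>R\<close>. On the rest,
  \<open>G\<close>, the totients are distinct multiples of \<open>2 ^ card S\<close> between 1 and
  \<open>n\<close>.\<close>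

lemma card_inj_on_totient_le:
  assumes inj: "inj_on totient A" and S: "finite S" "pairwise coprime S" "\<And>R. R \<in> S \<Longrightarrow> odd R"
  shows "card ({1..n} \<inter> A) \<le> n div 2 ^ card S + (\<Sum>R\<in>S. (n div R + 1) * totient R)"
proof -
  define G where "G = {x \<in> {1..n} \<inter> A. \<forall>R\<in>S. \<not> coprime x R}"
  have "card G \<le> card {1..n div 2 ^ card S}"
  proof (rule card_inj_on_le)
    show "inj_on (\<lambda>x. totient x div 2 ^ card S) G"
    proof (rule inj_onI)
      fix x y assume xy: "x \<in> G" "y \<in> G" "totient x div 2 ^ card S = totient y div 2 ^ card S"
      have "2 ^ card S dvd totient z" if "z \<in> G" for z
        using that S by (intro power_two_dvd_totient) (auto simp: G_def)
      hence "totient x = totient y"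
        using xy by (metis dvd_div_mult_self)
      thus "x = y" using inj xy by (auto simp: G_def inj_on_def)
    qed
    show "(\<lambda>x. totient x div 2 ^ card S) ` G \<subseteq> {1..n div 2 ^ card S}"
    proof (intro image_subsetI)
      fix x assume x: "x \<in> G"
      have "2 ^ card S dvd totient x"
        using x S by (intro power_two_dvd_totient) (auto simp: G_def)
      hence "2 ^ card S \<le> totient x" using x by (intro dvd_imp_le) (auto simp: G_def)
      moreover have "totient x \<le> n" using x totient_le[of x] by (auto simp: G_def)
      ultimately show "totient x div 2 ^ card S \<in> {1..n div 2 ^ card S}"
        by (auto simp: div_le_mono Suc_le_eq div_greater_zero_iff)
    qed
  qed auto
  moreover have "card (\<Union>R\<in>S. {x \<in> {1..n}. coprime x R}) \<le> (\<Sum>R\<in>S. (n div R + 1) * totient R)"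
    using S by (intro order.trans[OF card_UN_le] sum_mono card_coprime_le) (auto intro: odd_pos)
  moreover have "card ({1..n} \<inter> A) \<le> card (G \<union> (\<Union>R\<in>S. {x \<in> {1..n}. coprime x R}))"
    using S(1) by (intro card_mono) (auto simp: G_def)
  moreover note card_Un_le[of G "\<Union>R\<in>S. {x \<in> {1..n}. coprime x R}"]
  ultimately show ?thesis by simp
qed

text \<open>First \<open>k\<close>, then \<open>S\<close>, then \<open>n\<close> is chosen, so that
  each of \<open>(1 / 2) ^ k\<close>, \<open>k * \<epsilon>\<close> and \<open>C / n\<close> is at
  most \<open>e / 3\<close>, the first and last strictly.\<close>

lemma has_asymptotic_density_inj_on_totient:
  assumes inj: "inj_on totient A"
  shows "has_asymptotic_density A 0"
  unfolding has_asymptotic_density_def has_density_wrt_def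
proof (rule tendstoI)
  fix e :: real assume e: "e > 0"
  obtain k :: nat where k: "(1 / 2) ^ k < e / 3"
    using real_arch_pow_inv[of "e / 3" "1 / 2"] e by auto
  \<comment> \<open>The minimum with 1 meets the bound required to construct \<open>S\<close>;
    \<open>k + 1\<close> keeps the denominator nonzero for \<open>k = 0\<close>.\<close>
  define \<epsilon> where "\<epsilon> = min 1 (e / (3 * (real k + 1)))"
  have \<epsilon>: "0 < \<epsilon>" "\<epsilon> \<le> 1" using e by (auto simp: \<epsilon>_def)
  have "real k * \<epsilon> \<le> real k * (e / (3 * (real k + 1)))"
    by (intro mult_left_mono) (auto simp: \<epsilon>_def)
  also have "\<dots> \<le> e / 3" using e by (simp add: field_simps)
  finally have k\<epsilon>: "real k * \<epsilon> \<le> e / 3" .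
  obtain S where S: "finite S" "card S = k" "pairwise coprime S"
    "\<And>R. R \<in> S \<Longrightarrow> odd R \<and> real (totient R) / real R < \<epsilon>"
    using ex_pairwise_coprime_totient_ratio_less[OF \<epsilon>, of k] by blast
  \<comment> \<open>\<open>C\<close> collects the contributions of the \<open>+ 1\<close> in
    \<open>n div R + 1\<close>; it does not depend on \<open>n\<close>.\<close>
  define C where "C = real (\<Sum>R\<in>S. totient R)"
  have "(\<lambda>n. C / real n) \<longlonglongrightarrow> 0" by (rule lim_const_over_n)
  hence "\<forall>\<^sub>F n in sequentially. C / real n < e / 3"
    using e by (intro order_tendstoD) auto
  thus "\<forall>\<^sub>F n in sequentially. dist (real (card ({1..n} \<inter> A)) / real (card {1..n})) 0 < e"
    using eventually_gt_at_top[of 0]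
  proof eventually_elim
    case (elim n)
    have term_le: "real ((n div R + 1) * totient R) \<le> real n * \<epsilon> + real (totient R)" if "R \<in> S" for R
    proof -
      have "real (n div R) * real (totient R) \<le> real n / real R * real (totient R)"
        by (intro mult_right_mono of_nat_div_le_of_nat) auto
      also have "\<dots> = real n * (real (totient R) / real R)" by simp
      also have "\<dots> \<le> real n * \<epsilon>"
        using S(4)[OF that] by (intro mult_left_mono) auto
      finally show ?thesis by (simp add: algebra_simps)
    qed
    have "real (card ({1..n} \<inter> A))
        \<le> real (n div 2 ^ k + (\<Sum>R\<in>S. (n div R + 1) * totient R))"
      using card_inj_on_totient_le[OF inj S(1,3), of n] S(2,4) by (intro of_nat_mono) auto
    also have "\<dots> \<le> real n * (1 / 2) ^ k + (\<Sum>R\<in>S. real n * \<epsilon> + real (totient R))"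
    proof -
      have "real (n div 2 ^ k) \<le> real n * (1 / 2) ^ k"
        using of_nat_div_le_of_nat[of n "2 ^ k", where ?'a = real] by (simp add: power_divide)
      moreover have "(\<Sum>R\<in>S. real ((n div R + 1) * totient R))
          \<le> (\<Sum>R\<in>S. real n * \<epsilon> + real (totient R))"
        by (intro sum_mono term_le)
      ultimately show ?thesis unfolding of_nat_add of_nat_sum by (rule add_mono)
    qed
    also have "\<dots> = real n * ((1 / 2) ^ k + real k * \<epsilon> + C / real n)"
      using elim S(2) by (simp add: sum.distrib C_def field_simps)
    also have "\<dots> < real n * e"
    proof (rule mult_strict_left_mono)
      show "(1 / 2) ^ k + real k * \<epsilon> + C / real n < e"
        using elim(1) k k\<epsilon> by linarith
    qed (use elim in simp)
    finally show ?case using elim by (simp add: field_simps)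
  qed
qed

text \<open>\<open>totient\<close> undoes \<open>f\<close>, hence is injective on its image.\<close>

lemma has_asymptotic_density_totient_section:
  assumes f: "\<And>m. m \<in> totient_values \<Longrightarrow> f m \<in> totient_preimage m"
  shows "has_asymptotic_density (f ` totient_values) 0"
proof (rule has_asymptotic_density_inj_on_totient)
  have "totient (f m) = m" if "m \<in> totient_values" for m
    using f[OF that] by (simp add: totient_preimage_def)
  thus "inj_on totient (f ` totient_values)" by (auto simp: inj_on_def)
qed

theorem theorem1p3:
  shows "banach_density (N\<^sub>1 ` totient_values) = 0
    \<and> (\<forall>f :: nat \<Rightarrow> nat. (\<forall>m\<in>totient_values. f m \<in> totient_preimage m)
          \<longrightarrow> has_asymptotic_density (f ` totient_values) 0)
    \<and> has_asymptotic_density (N\<^sub>2 ` totient_values) 0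
    \<and> has_asymptotic_density (N\<^sub>3 ` totient_values) 0"
proof (intro conjI allI impI)
  \<comment> \<open>The threshold \<open>K\<close> for a prime \<open>p\<close> is
    \<open>p\<^sup>2 * fact (p\<^sup>2)\<close>.\<close>
  show "banach_density (N\<^sub>1 ` totient_values) = 0"
    using prime_dvd_sparsely_totient N1_sparsely_totient
    by (intro banach_density_eventually_divisible) blast
  have nonempty: "totient_preimage m \<noteq> {}" if "m \<in> totient_values" for m
    using that by (auto simp: totient_values_def totient_preimage_def)
  show "has_asymptotic_density (N\<^sub>2 ` totient_values) 0"
    unfolding N\<^sub>2_def
    by (intro has_asymptotic_density_totient_section Max_in finite_totient_preimage nonempty)
  show "has_asymptotic_density (N\<^sub>3 ` totient_values) 0"
    unfolding N\<^sub>3_def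
    by (intro has_asymptotic_density_totient_section Min_in finite_totient_preimage nonempty)
qed (auto intro: has_asymptotic_density_totient_section)

end
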